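(* The ideal $\mathcal Z$ of subsets of $\omega$ of asymptotic density $0$ is not an HL ideal.
   Context: $\mathcal Z=\{A\subseteq\omega:\lim_{n\to\infty}|A\cap n|/n=0\}$. A tree is an initial subset of $(2^{<\omega},\subseteq)$ without maximal elements, perfect if every node has two incompatible extensions in it; $\mathbf S$ is the set of perfect trees; $p\restriction A=\{s\in p\cap2^n:n\in A\}$. An ideal $\mathcal I$ on $\omega$ is HL if for every $c:2^{<\omega}\to2$ there are $p\in\mathbf S$ and $A\in\mathcal I^+=\mathcal P(\omega)\setminus\mathcal I$ with $c$ constant on $p\restriction A$. *)

theory Defs
  imports Complex_Main "HOL-Library.Sublist"
begin

definition ideal_on_omega :: "nat set set \<Rightarrow> bool" where
  "ideal_on_omega I \<longleftrightarrow>
     (\<forall>A\<in>I. \<forall>B. B \<subseteq> A \<longrightarrow> B \<in> I) \<and>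
     (\<forall>A\<in>I. \<forall>B\<in>I. A \<union> B \<in> I) \<and>
     (\<forall>A. finite A \<longrightarrow> A \<in> I) \<and>
     UNIV \<notin> I"

definition density_zero :: "nat set set" where
  "density_zero = {A. (\<lambda>n. real (card (A \<inter> {..<n})) / real n) \<longlonglongrightarrow> 0}"

text \<open>The nodes of the full binary tree are the finite sequences of type \<^typ>\<open>bool list\<close>, ordered by
  \<^const>\<open>prefix\<close>; two nodes are incompatible if they are \<^const>\<open>parallel\<close>.
  Trees are required to be nonempty: otherwise the empty set would be a perfect tree, and every
  ideal on \<open>\<omega>\<close> would vacuously be HL.\<close>

definition binary_tree :: "bool list set \<Rightarrow> bool" where
  "binary_tree p \<longleftrightarrow>
     p \<noteq> {} \<and>
     (\<forall>t\<in>p. \<forall>s. prefix s t \<longrightarrow> s \<in> p) \<and>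
     (\<forall>s\<in>p. \<exists>t\<in>p. strict_prefix s t)"

definition perfect_trees :: "bool list set set" where
  "perfect_trees =
     {p. binary_tree p \<and>
         (\<forall>s\<in>p. \<exists>t\<in>p. \<exists>u\<in>p. prefix s t \<and> prefix s u \<and> t \<parallel> u)}"

definition tree_restrict :: "bool list set \<Rightarrow> nat set \<Rightarrow> bool list set" where
  "tree_restrict p A = {s \<in> p. length s \<in> A}"

definition HL :: "nat set set \<Rightarrow> bool" where
  "HL I \<longleftrightarrow>
     (\<forall>c :: bool list \<Rightarrow> bool. \<exists>p\<in>perfect_trees. \<exists>A. A \<notin> I \<and>
        (\<exists>i. \<forall>s\<in>tree_restrict p A. c s = i))"

text \<open>The predicate \<^const>\<open>HL\<close> is the colouring property alone; that it is applied to an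
  ideal below is justified by the following fact.\<close>

lemma density_zero_bound:
  assumes "\<And>n. real (card (A \<inter> {..<n})) / real n \<le> f n" and "f \<longlonglongrightarrow> 0"
  shows "A \<in> density_zero"
proof -
  have "(\<lambda>n. real (card (A \<inter> {..<n})) / real n) \<longlonglongrightarrow> 0"
    by (rule tendsto_sandwich[OF _ _ tendsto_const assms(2)]) (use assms(1) in auto)
  then show ?thesis
    by (simp add: density_zero_def)
qed

lemma ideal_on_omega_density_zero: "ideal_on_omega density_zero"
  unfolding ideal_on_omega_def
proof (intro conjI ballI allI impI)
  fix A B assume A: "A \<in> density_zero" and "B \<subseteq> A"
  then have "card (B \<inter> {..<n}) \<le> card (A \<inter> {..<n})" for n
    by (intro card_mono) auto
  then have "real (card (B \<inter> {..<n})) / real n \<le> real (card (A \<inter> {..<n})) / real n" for n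
    by (simp add: divide_right_mono)
  then show "B \<in> density_zero"
    by (rule density_zero_bound) (use A in \<open>simp add: density_zero_def\<close>)
next
  fix A B assume A: "A \<in> density_zero" and B: "B \<in> density_zero"
  have "real (card ((A \<union> B) \<inter> {..<n})) / real n
      \<le> real (card (A \<inter> {..<n})) / real n + real (card (B \<inter> {..<n})) / real n" for n
  proof -
    have "card ((A \<union> B) \<inter> {..<n}) \<le> card (A \<inter> {..<n}) + card (B \<inter> {..<n})"
      by (simp add: Int_Un_distrib2 card_Un_le)
    then show ?thesis
      by (metis add_divide_distrib divide_right_mono of_nat_0_le_iff of_nat_add of_nat_mono)
  qed
  moreover have "(\<lambda>n. real (card (A \<inter> {..<n})) / real n + real (card (B \<inter> {..<n})) / real n)
      \<longlonglongrightarrow> 0"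
    using A B tendsto_add[of _ 0 sequentially _ 0] unfolding density_zero_def by force
  ultimately show "A \<union> B \<in> density_zero"
    by (rule density_zero_bound)
next
  fix A :: "nat set" assume "finite A"
  then have "card (A \<inter> {..<n}) \<le> card A" for n
    by (simp add: card_mono)
  then have "real (card (A \<inter> {..<n})) / real n \<le> real (card A) / real n" for n
    by (simp add: divide_right_mono)
  moreover have "(\<lambda>n. real (card A) / real n) \<longlonglongrightarrow> 0"
    by (rule lim_const_over_n)
  ultimately show "A \<in> density_zero"
    by (rule density_zero_bound)
next
  show "UNIV \<notin> density_zero"
  proof
    assume "UNIV \<in> density_zero"
    then have "(\<lambda>n. real n / real n) \<longlonglongrightarrow> 0"
      by (simp add: density_zero_def)
    moreover have "eventually (\<lambda>n. real n / real n = 1) sequentially"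
      using eventually_gt_at_top[of 0] by eventually_elim simp
    then have "(\<lambda>n. real n / real n) \<longlonglongrightarrow> 1"
      by (rule tendsto_eventually)
    ultimately show False
      using LIMSEQ_unique by fastforce
  qed
qed

end

theory Submission
  imports Defs
begin

text \<open>Colour a node \<open>s\<close> of length \<open>n\<close> by the Walsh character \<open>\<Prod>j. (-1)^(s\<^sub>j n\<^sub>j)\<close>, where \<open>n\<^sub>j\<close> are
  the binary digits of \<open>n\<close>. Given a perfect tree, choose \<open>m\<close> pairwise incompatible nodes of it, all
  of length at most \<open>L\<close>, and extend them beyond an aligned block of \<open>2^L\<close> consecutive levels. The
  extensions induce \<open>m\<close> pairwise orthogonal \<open>\<plusminus>1\<close>-valued functions on the block, so the square of
  their sum adds up to \<open>m 2^L\<close>. Each level at which the tree is monochromatic contributes \<open>m\<^sup>2\<close>,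
  hence at most \<open>2^L / m\<close> levels of every block are monochromatic. As \<open>m\<close> is arbitrary, the
  monochromatic levels have density zero.\<close>

section \<open>Walsh characters of nodes\<close>

definition walsh :: "bool list \<Rightarrow> nat \<Rightarrow> int" where
  "walsh t n = (\<Prod>j<length t. if t ! j \<and> bit n j then - 1 else 1)"

definition walsh_colouring :: "bool list \<Rightarrow> bool" where
  "walsh_colouring s \<longleftrightarrow> walsh s (length s) = 1"

text \<open>Aligned at a multiple of \<open>2 ^ L\<close>: membership fixes the binary digits from
  position \<open>L\<close> on and leaves the lower \<open>L\<close> digits free.\<close>

definition dyadic_block :: "nat \<Rightarrow> nat \<Rightarrow> nat set" where
  "dyadic_block L q = {q * 2 ^ L..<(q + 1) * 2 ^ L}"

lemma walsh_cases: "walsh t n = 1 \<or> walsh t n = - 1"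
proof -
  have "(\<Prod>j\<in>J. if t ! j \<and> bit n j then - 1 else 1) \<in> {1, - 1 :: int}" if "finite J" for J
    using that by induction auto
  then show ?thesis
    by (auto simp: walsh_def)
qed

lemma walsh_square: "walsh t n * walsh t n = 1"
  using walsh_cases[of t n] by auto

text \<open>Since \<open>n < 2 ^ j\<close> for \<open>j \<ge> n\<close>, the digits of
  \<open>n\<close> at the positions cut off vanish and their factors are 1. Thus one long node
  encodes the colours of all its initial segments.\<close>

lemma walsh_take:
  assumes "n \<le> length t"
  shows "walsh (take n t) n = walsh t n"
proof -
  have "\<not> bit n j" if "n \<le> j" for j
  proof -
    have "n < 2 ^ j"
      using that less_exp[of j] by linarith
    then show ?thesis
      by (simp add: bit_iff_odd)
  qed
  then show ?thesis
    unfolding walsh_def using assms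
    by (intro prod.mono_neutral_cong_left) auto
qed

lemma walsh_flip_bit:
  assumes "d < length t"
  shows "walsh t (flip_bit d n) = (if t ! d then - walsh t n else walsh t n)"
proof -
  have "walsh t m = (if t ! d \<and> bit m d then - 1 else 1) *
      (\<Prod>j\<in>{..<length t} - {d}. if t ! j \<and> bit m j then - 1 else 1)" for m
    unfolding walsh_def using assms by (intro prod.remove) auto
  moreover have "(\<Prod>j\<in>{..<length t} - {d}. if t ! j \<and> bit (flip_bit d n) j then - 1 else 1 :: int) =
      (\<Prod>j\<in>{..<length t} - {d}. if t ! j \<and> bit n j then - 1 else 1)"
    by (intro prod.cong) (auto simp: bit_flip_bit_iff)
  ultimately show ?thesis
    by (simp add: bit_flip_bit_iff)
qed

section \<open>Orthogonality on dyadic blocks\<close>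

lemma dyadic_block_iff: "n \<in> dyadic_block L q \<longleftrightarrow> n div 2 ^ L = q"
proof
  show "n div 2 ^ L = q" if "n \<in> dyadic_block L q"
    using that by (intro div_nat_eqI) (auto simp: dyadic_block_def mult.commute)
  show "n \<in> dyadic_block L q" if "n div 2 ^ L = q"
    using that dividend_less_div_times[of "2 ^ L" n] div_times_less_eq_dividend[of n "2 ^ L"]
    by (auto simp: dyadic_block_def)
qed

lemma flip_bit_in_dyadic_block:
  assumes "d < L" "n \<in> dyadic_block L q"
  shows "flip_bit d n \<in> dyadic_block L q"
proof -
  have "drop_bit L (flip_bit d n) = drop_bit L n"
    using assms(1) by (intro bit_eqI) (auto simp: bit_drop_bit_eq bit_flip_bit_iff)
  then show ?thesis
    using assms(2) by (simp add: dyadic_block_iff drop_bit_eq_div)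
qed

text \<open>Flipping digit \<open>d\<close> is an involution of the block that changes the sign of
  exactly one of the two characters, so the sum equals its own negative.\<close>

lemma walsh_orthogonal:
  assumes "d < L" "d < length s" "d < length t" "s ! d \<noteq> t ! d"
  shows "(\<Sum>n\<in>dyadic_block L q. walsh s n * walsh t n) = 0"
proof -
  have flip: "flip_bit d (flip_bit d n) = n" for n :: nat
    by (intro bit_eqI) (auto simp: bit_flip_bit_iff)
  have "(\<Sum>n\<in>dyadic_block L q. walsh s n * walsh t n) =
      (\<Sum>n\<in>dyadic_block L q. walsh s (flip_bit d n) * walsh t (flip_bit d n))"
    by (rule sum.reindex_bij_witness[of _ "flip_bit d" "flip_bit d"])
      (use assms(1) flip flip_bit_in_dyadic_block in auto)
  also have "\<dots> = (\<Sum>n\<in>dyadic_block L q. - (walsh s n * walsh t n))"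
    using assms by (intro sum.cong) (auto simp: walsh_flip_bit)
  finally show ?thesis
    by (simp add: sum_negf)
qed

text \<open>A second-moment estimate for the sum of the characters. In \<open>differ\<close> the
  position \<open>d\<close> must lie below \<open>L\<close>, since flipping such a digit keeps a
  level inside the block.\<close>

lemma card_walsh_constant_le:
  assumes "finite F" "F \<noteq> {}"
    and differ: "\<And>s t. s \<in> F \<Longrightarrow> t \<in> F \<Longrightarrow> s \<noteq> t \<Longrightarrow>
      \<exists>d<L. d < length (e s) \<and> d < length (e t) \<and> e s ! d \<noteq> e t ! d"
    and "B \<subseteq> dyadic_block L q"
    and const: "\<And>n s. n \<in> B \<Longrightarrow> s \<in> F \<Longrightarrow> walsh (e s) n = 1 \<longleftrightarrow> i"
  shows "card B * card F \<le> 2 ^ L"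
proof -
  define S where "S n = (\<Sum>s\<in>F. walsh (e s) n)" for n
  have S_B: "S n * S n = int (card F) * int (card F)" if "n \<in> B" for n
  proof -
    have "walsh (e s) n = (if i then 1 else - 1)" if "s \<in> F" for s
      using const[OF \<open>n \<in> B\<close> that] walsh_cases[of "e s" n] by auto
    then have "S n = (\<Sum>s\<in>F. if i then 1 else - 1)"
      unfolding S_def by (rule sum.cong[OF refl])
    then show ?thesis
      by auto
  qed
  have "int (card B) * (int (card F) * int (card F)) = (\<Sum>n\<in>B. S n * S n)"
    using S_B by simp
  also have "\<dots> \<le> (\<Sum>n\<in>dyadic_block L q. S n * S n)"
    using assms(4) by (intro sum_mono2) (auto simp: dyadic_block_def)
  also have "\<dots> = (\<Sum>n\<in>dyadic_block L q. \<Sum>s\<in>F. \<Sum>t\<in>F. walsh (e s) n * walsh (e t) n)"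
    by (simp add: S_def sum_product)
  also have "\<dots> = (\<Sum>s\<in>F. \<Sum>n\<in>dyadic_block L q. \<Sum>t\<in>F. walsh (e s) n * walsh (e t) n)"
    by (rule sum.swap)
  also have "\<dots> = (\<Sum>s\<in>F. \<Sum>t\<in>F. \<Sum>n\<in>dyadic_block L q. walsh (e s) n * walsh (e t) n)"
    by (intro sum.cong refl sum.swap)
  \<comment> \<open>Only the diagonal survives: there the product is 1 at each of the
    \<open>2 ^ L\<close> levels of the block.\<close>
  also have "\<dots> = (\<Sum>s\<in>F. \<Sum>t\<in>F. if s = t then 2 ^ L else 0)"
  proof (intro sum.cong refl)
    fix s t assume "s \<in> F" "t \<in> F"
    show "(\<Sum>n\<in>dyadic_block L q. walsh (e s) n * walsh (e t) n) = (if s = t then 2 ^ L else 0)"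
    proof (cases "s = t")
      case True
      then show ?thesis
        by (simp add: walsh_square dyadic_block_def)
    next
      case False
      then show ?thesis
        using differ[OF \<open>s \<in> F\<close> \<open>t \<in> F\<close>] walsh_orthogonal by auto
    qed
  qed
  also have "\<dots> = int (card F) * 2 ^ L"
    using assms(1) by simp
  finally have "int (card F) * (int (card B) * int (card F)) \<le> int (card F) * 2 ^ L"
    by (simp add: ac_simps)
  moreover have "0 < int (card F)"
    using assms(1,2) by (simp add: card_gt_0_iff)
  ultimately have "int (card B * card F) \<le> int (2 ^ L)"
    by simp
  then show ?thesis
    by linarith
qed

section \<open>Antichains and monochromatic levels in perfect trees\<close>

lemma binary_tree_long_extension:
  assumes "binary_tree p" "s \<in> p"
  shows "\<exists>t\<in>p. prefix s t \<and> N \<le> length t"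
proof (induction N)
  case 0
  then show ?case
    using assms(2) by auto
next
  case (Suc N)
  then obtain t where t: "t \<in> p" "prefix s t" "N \<le> length t"
    by auto
  then obtain u where "u \<in> p" "strict_prefix t u"
    using assms(1) unfolding binary_tree_def by blast
  with t show ?case
    by (meson Suc_leI le_less_trans prefix_length_less prefix_order.less_imp_le
        prefix_order.trans)
qed

text \<open>By induction: replacing one member of an antichain by two incompatible extensions of it
  enlarges the antichain by one.\<close>

lemma perfect_tree_antichain:
  assumes "p \<in> perfect_trees"
  shows "\<exists>F\<subseteq>p. finite F \<and> card F = Suc m \<and> (\<forall>s\<in>F. \<forall>t\<in>F. s \<noteq> t \<longrightarrow> s \<parallel> t)"
proof (induction m)
  case 0
  obtain s where "s \<in> p"
    using assms by (auto simp: perfect_trees_def binary_tree_def)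
  then show ?case
    by (intro exI[of _ "{s}"]) auto
next
  case (Suc m)
  then obtain F where F: "F \<subseteq> p" "finite F" "card F = Suc m"
    and par: "\<And>s t. s \<in> F \<Longrightarrow> t \<in> F \<Longrightarrow> s \<noteq> t \<Longrightarrow> s \<parallel> t"
    by blast
  then obtain s where s: "s \<in> F"
    by fastforce
  then obtain t u where tu: "t \<in> p" "u \<in> p" "prefix s t" "prefix s u" "t \<parallel> u"
    using assms F(1) by (fastforce simp: perfect_trees_def)
  \<comment> \<open>If \<open>x\<close> were comparable with an extension \<open>v\<close> of
    \<open>s\<close>, it would be comparable with \<open>s\<close>: either both are prefixes of
    \<open>v\<close>, or \<open>s\<close> is a prefix of \<open>v\<close> and hence of
    \<open>x\<close>.\<close>
  have ext: "x \<parallel> v" "v \<parallel> x" if "x \<in> F - {s}" "prefix s v" for x v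
    using par[of x s] that s prefix_same_cases[of x v s] prefix_order.trans[of s v x]
    by (auto simp: parallel_def)
  define G where "G = insert t (insert u (F - {s}))"
  have "t \<notin> insert u (F - {s})" "u \<notin> F - {s}"
    using ext tu by (auto simp: parallel_def)
  then have "card G = Suc (Suc m)"
    using F s by (simp add: G_def)
  moreover have "\<forall>x\<in>G. \<forall>y\<in>G. x \<noteq> y \<longrightarrow> x \<parallel> y"
    using ext tu par parallel_commute by (auto simp: G_def)
  ultimately show ?case
    using F tu by (intro exI[of _ G] conjI) (auto simp: G_def)
qed

lemma parallel_imp_nth_differ:
  assumes "s \<parallel> t"
  shows "\<exists>d. d < length s \<and> d < length t \<and> s ! d \<noteq> t ! d"
proof -
  obtain as b bs c cs where "b \<noteq> c" "s = as @ b # bs" "t = as @ c # cs"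
    using parallel_decomp[OF assms] by blast
  then show ?thesis
    by (intro exI[of _ "length as"]) auto
qed

text \<open>The antichain, and with it \<open>L\<close>, is chosen before \<open>q\<close>; only the
  extensions of its members depend on the block. This uniformity permits summing over
  blocks.\<close>

lemma monochromatic_levels_in_block:
  assumes p: "p \<in> perfect_trees"
    and const: "\<forall>s\<in>tree_restrict p A. walsh_colouring s = i"
  shows "\<exists>L. \<forall>q. card (A \<inter> dyadic_block L q) * Suc m \<le> 2 ^ L"
proof -
  have tree: "binary_tree p"
    using p by (simp add: perfect_trees_def)
  obtain F where F: "F \<subseteq> p" "finite F" "card F = Suc m"
    and par: "\<And>s t. s \<in> F \<Longrightarrow> t \<in> F \<Longrightarrow> s \<noteq> t \<Longrightarrow> s \<parallel> t"
    using perfect_tree_antichain[OF p, of m] by metis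
  \<comment> \<open>All members of \<open>F\<close> have length at most \<open>L\<close>, so any two
    of them already differ at a position below \<open>L\<close>.\<close>
  define L where "L = Max (length ` F)"
  have L: "length s \<le> L" if "s \<in> F" for s
    using that F(2) by (simp add: L_def)
  have "card (A \<inter> dyadic_block L q) * card F \<le> 2 ^ L" for q
  proof -
    \<comment> \<open>The extensions reach beyond the block, so they can be truncated to a node of
      \<open>p\<close> at each of its levels.\<close>
    have "\<forall>s\<in>F. \<exists>t\<in>p. prefix s t \<and> (q + 1) * 2 ^ L \<le> length t"
      using binary_tree_long_extension[OF tree] F(1) by blast
    then obtain e where e: "\<And>s. s \<in> F \<Longrightarrow> e s \<in> p" "\<And>s. s \<in> F \<Longrightarrow> prefix s (e s)"
      "\<And>s. s \<in> F \<Longrightarrow> (q + 1) * 2 ^ L \<le> length (e s)"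
      by metis
    show ?thesis
    proof (rule card_walsh_constant_le[where e = e and q = q and i = i])
      show "F \<noteq> {}"
        using F(3) by auto
    next
      fix s t assume st: "s \<in> F" "t \<in> F" "s \<noteq> t"
      then obtain d where d: "d < length s" "d < length t" "s ! d \<noteq> t ! d"
        using parallel_imp_nth_differ[OF par] by blast
      obtain s' t' where "e s = s @ s'" "e t = t @ t'"
        using e(2) st by (meson prefixE)
      with d L[OF st(1)]
      show "\<exists>d<L. d < length (e s) \<and> d < length (e t) \<and> e s ! d \<noteq> e t ! d"
        by (intro exI[of _ d]) (auto simp: nth_append)
    next
      fix n s assume n: "n \<in> A \<inter> dyadic_block L q" and s: "s \<in> F"
      then have le: "n \<le> length (e s)"
        using e(3)[OF s] by (auto simp: dyadic_block_def)
      have "take n (e s) \<in> p"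
        using tree e(1)[OF s] take_is_prefix unfolding binary_tree_def by blast
      then have "walsh_colouring (take n (e s)) = i"
        using const n le by (simp add: tree_restrict_def)
      then show "walsh (e s) n = 1 \<longleftrightarrow> i"
        using le walsh_take[OF le] by (simp add: walsh_colouring_def)
    qed (use F in auto)
  qed
  then show ?thesis
    using F(3) by metis
qed

section \<open>From blocks to asymptotic density\<close>

lemma card_le_of_dyadic_blocks:
  assumes "\<And>q. card (A \<inter> dyadic_block L q) * m \<le> 2 ^ L"
  shows "card (A \<inter> {..<n}) * m \<le> n + 2 ^ L"
proof -
  have "A \<inter> {..<n} \<subseteq> (\<Union>q\<le>n div 2 ^ L. A \<inter> dyadic_block L q)"
    by (auto simp: dyadic_block_iff div_le_mono)
  then have "card (A \<inter> {..<n}) \<le> card (\<Union>q\<le>n div 2 ^ L. A \<inter> dyadic_block L q)"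
    by (intro card_mono) (auto simp: dyadic_block_def)
  also have "\<dots> \<le> (\<Sum>q\<le>n div 2 ^ L. card (A \<inter> dyadic_block L q))"
    by (intro card_UN_le) simp
  finally have "card (A \<inter> {..<n}) * m \<le> (\<Sum>q\<le>n div 2 ^ L. card (A \<inter> dyadic_block L q) * m)"
    by (metis mult_le_mono1 sum_distrib_right)
  also have "\<dots> \<le> (\<Sum>q\<le>n div 2 ^ L. 2 ^ L)"
    by (intro sum_mono assms)
  \<comment> \<open>There are \<open>n div 2 ^ L + 1\<close> summands; the last block, possibly cut
    by \<open>n\<close>, accounts for the extra \<open>2 ^ L\<close>.\<close>
  also have "\<dots> \<le> n + 2 ^ L"
    by simp
  finally show ?thesis .
qed

lemma density_zeroI:
  assumes "\<And>m. \<exists>K. \<forall>n. card (A \<inter> {..<n}) * Suc m \<le> n + K"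
  shows "A \<in> density_zero"
  unfolding density_zero_def mem_Collect_eq
proof (rule LIMSEQ_I)
  fix r :: real assume "0 < r"
  \<comment> \<open>Half of \<open>r\<close> suffices: once \<open>n\<close> exceeds
    \<open>K\<close>, the bound \<open>n + K\<close> is at most \<open>2 * n\<close>, which costs a
    factor 2.\<close>
  then obtain m where m: "inverse (real (Suc m)) < r / 2"
    using reals_Archimedean[of "r / 2"] by auto
  obtain K where K: "\<And>n. card (A \<inter> {..<n}) * Suc m \<le> n + K"
    using assms by blast
  have "norm (real (card (A \<inter> {..<n})) / real n - 0) < r" if "Suc K \<le> n" for n
  proof -
    have "card (A \<inter> {..<n}) * Suc m \<le> 2 * n"
      using K[of n] that by linarith
    then have "real (card (A \<inter> {..<n})) * real (Suc m) \<le> 2 * real n"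
      by (metis of_nat_le_iff of_nat_mult of_nat_numeral)
    then have "real (card (A \<inter> {..<n})) / real n \<le> 2 * inverse (real (Suc m))"
      using that by (simp add: field_simps)
    with m show ?thesis
      by simp
  qed
  then show "\<exists>no. \<forall>n\<ge>no. norm (real (card (A \<inter> {..<n})) / real n - 0) < r"
    by blast
qed

theorem theorem3p16:
  shows "\<not> HL density_zero"
proof
  assume "HL density_zero"
  then obtain p A i where "p \<in> perfect_trees" "A \<notin> density_zero"
    "\<forall>s\<in>tree_restrict p A. walsh_colouring s = i"
    unfolding HL_def by blast
  moreover from this have "\<exists>K. \<forall>n. card (A \<inter> {..<n}) * Suc m \<le> n + K" for m
    using monochromatic_levels_in_block[of p A i m] card_le_of_dyadic_blocks by blast
  ultimately show False
    using density_zeroI by blast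
qed

end
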